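(* Let $R$ be a field of characteristic $0$ (or, more generally, a commutative ring in a setting in which the Homotopy Transfer Theorem holds, i.e. in which the operations $m_n^Y$ described in the context define an $A_\infty$-algebra structure on $Y$). Let $X$ be a dg algebra over $R$. Consider a deformation retract of complexes of $R$-modules $$i\colon (Y,\partial^Y)\to (X,\partial^X),\qquad p\colon (X,\partial^X)\to (Y,\partial^Y),$$ with associated homotopy $h$ on $X$, such that $h$ satisfies the generalized Leibniz rule and $hi=0$. Then the $A_\infty$-algebra structure on $Y$ obtained from the dg algebra structure on $X$ by the Homotopy Transfer Theorem has trivial higher operations, that is, $m_n^Y=0$ for all $n\ge 3$.
   Context: Complexes are complexes of $R$-modules, graded homologically. A dg algebra over $R$ is a complex $(X,\partial)$ of $R$-modules in nonnegative degrees with an associative, unitary product ($1\in X_0$) given by a chain map $X\otimes_R X\to X$ (equivalently, $\partial$ satisfies the Leibniz rule $\partial(\alpha\beta)=\partial(\alpha)\beta+(-1)^{|\alpha|}\alpha\partial(\beta)$), which is strictly graded commutative: $\alpha\beta=(-1)^{|\alpha||\beta|}\beta\alpha$, and $\alpha^2=0$ for $|\alpha|$ odd. A deformation retract consists of quasi-isomorphisms of complexes $i\colon Y\to X$, $p\colon X\to Y$ and a homotopy $h$ on $X$ (graded $R$-linear of degree $1$) with $ip=1+\partial^Xh+h\partial^X$ and $pi=1$. $h$ satisfies the generalized Leibniz rule if $h(\alpha\beta)\in h(\alpha)X+Xh(\beta)$ for all $\alpha,\beta\in X$. An $A_\infty$-algebra over $R$ is a complex $A$ of $R$-modules with $R$-multilinear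 maps $m_n\colon A^{\otimes n}\to A$ of degree $n-2$ for $n\ge1$, with $m_1=\partial_A$, satisfying for all $n\ge 1$ the Stasheff identities $\sum (-1)^{r+st}m_{r+1+t}(1^{\otimes r}\otimes m_s\otimes 1^{\otimes t})=0$, summed over $s\ge1$, $r,t\ge0$ with $r+s+t=n$; the Koszul sign rule $(f\otimes g)(x\otimes y)=(-1)^{|g||x|}f(x)\otimes g(y)$ is used throughout. Homotopy Transfer Theorem for dg algebras: let $m_2\colon X\otimes X\to X$ be the product of $X$. The transferred $A_\infty$-structure on $Y$ has $m_1^Y=\partial^Y$ and, for $n\ge 2$, $$m_n^Y=\sum_{T\in PBT_n}\epsilon_T\, m_T ,$$ where $PBT_n$ is the set of planar binary rooted trees with $n$ leaves, $\epsilon_T\in\{1,-1\}$ are the signs given by the Homotopy Transfer Theorem (their precise values are not needed here), and $m_T\colon Y^{\otimes n}\to Y$ is defined as follows. For the trivial tree (a single leaf) put $\varphi_{|}=i$. If $T$ has at least two leaves, with left and right subtrees $T_1,T_2$ at the root, put $\varphi_T=h\,m_2(\varphi_{T_1}\otimes\varphi_{T_2})$ and $m_T=p\,m_2(\varphi_{T_1}\otimes\varphi_{T_2})$. In other words, $i$ is applied at each leaf, $m_2$ at each internal vertex, each product is followed by $h$, except the last one (at the root), which is followed by $p$. *)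

theory Defs
  imports "HOL-Algebra.Module" "HOL-Algebra.AbelCoset"
begin

section \<open>Complexes of modules\<close>

text \<open>
  A graded module is a family of modules indexed by the integers, and every element is homogeneous.
  A map of graded modules of degree \<open>k\<close> is a family \<open>f\<close> with \<open>f n\<close> defined on component \<open>n\<close>
  and taking values in component \<open>n + k\<close>.
\<close>

definition linear_maps ::
  "('r, 'k) ring_scheme \<Rightarrow> ('r, 'a, 'm) module_scheme \<Rightarrow> ('r, 'b, 'n) module_scheme \<Rightarrow> ('a \<Rightarrow> 'b) set"
  where "linear_maps R M N =
    {f \<in> carrier M \<rightarrow> carrier N.
      (\<forall>x\<in>carrier M. \<forall>y\<in>carrier M. f (x \<oplus>\<^bsub>M\<^esub> y) = f x \<oplus>\<^bsub>N\<^esub> f y) \<and>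
      (\<forall>c\<in>carrier R. \<forall>x\<in>carrier M. f (c \<odot>\<^bsub>M\<^esub> x) = c \<odot>\<^bsub>N\<^esub> f x)}"

locale complex_of_modules = cring R
  for R :: "('r, 'k) ring_scheme" (structure)
    and X :: "int \<Rightarrow> ('r, 'x, 'm) module_scheme"
    and d :: "int \<Rightarrow> 'x \<Rightarrow> 'x" +
  assumes component_module: "module R (X n)"
    and d_linear: "d n \<in> linear_maps R (X n) (X (n - 1))"
    and d_square: "x \<in> carrier (X n) \<Longrightarrow> d (n - 1) (d n x) = \<zero>\<^bsub>X (n - 2)\<^esub>"

definition chain_map ::
  "('r, 'k) ring_scheme \<Rightarrow> (int \<Rightarrow> ('r, 'a, 'm) module_scheme) \<Rightarrow> (int \<Rightarrow> 'a \<Rightarrow> 'a) \<Rightarrow>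
   (int \<Rightarrow> ('r, 'b, 'n) module_scheme) \<Rightarrow> (int \<Rightarrow> 'b \<Rightarrow> 'b) \<Rightarrow> (int \<Rightarrow> 'a \<Rightarrow> 'b) \<Rightarrow> bool"
  where "chain_map R A dA B dB f \<longleftrightarrow>
    (\<forall>n. f n \<in> linear_maps R (A n) (B n)) \<and>
    (\<forall>n. \<forall>x\<in>carrier (A n). f (n - 1) (dA n x) = dB n (f n x))"

definition cycles :: "(int \<Rightarrow> ('r, 'a, 'm) module_scheme) \<Rightarrow> (int \<Rightarrow> 'a \<Rightarrow> 'a) \<Rightarrow> int \<Rightarrow> 'a set"
  where "cycles A d n = {x \<in> carrier (A n). d n x = \<zero>\<^bsub>A (n - 1)\<^esub>}"

definition boundaries :: "(int \<Rightarrow> ('r, 'a, 'm) module_scheme) \<Rightarrow> (int \<Rightarrow> 'a \<Rightarrow> 'a) \<Rightarrow> int \<Rightarrow> 'a set"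
  where "boundaries A d n = d (n + 1) ` carrier (A (n + 1))"

definition homology :: "(int \<Rightarrow> ('r, 'a, 'm) module_scheme) \<Rightarrow> (int \<Rightarrow> 'a \<Rightarrow> 'a) \<Rightarrow> int \<Rightarrow> 'a set set"
  where "homology A d n = (\<lambda>z. boundaries A d n +>\<^bsub>A n\<^esub> z) ` cycles A d n"

definition homology_map ::
  "(int \<Rightarrow> ('r, 'b, 'n) module_scheme) \<Rightarrow> (int \<Rightarrow> 'b \<Rightarrow> 'b) \<Rightarrow> (int \<Rightarrow> 'a \<Rightarrow> 'b) \<Rightarrow>
   int \<Rightarrow> 'a set \<Rightarrow> 'b set"
  where "homology_map B dB f n C = the_elem ((\<lambda>z. boundaries B dB n +>\<^bsub>B n\<^esub> f n z) ` C)"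

definition quasi_isomorphism ::
  "('r, 'k) ring_scheme \<Rightarrow> (int \<Rightarrow> ('r, 'a, 'm) module_scheme) \<Rightarrow> (int \<Rightarrow> 'a \<Rightarrow> 'a) \<Rightarrow>
   (int \<Rightarrow> ('r, 'b, 'n) module_scheme) \<Rightarrow> (int \<Rightarrow> 'b \<Rightarrow> 'b) \<Rightarrow> (int \<Rightarrow> 'a \<Rightarrow> 'b) \<Rightarrow> bool"
  where "quasi_isomorphism R A dA B dB f \<longleftrightarrow>
    chain_map R A dA B dB f \<and>
    (\<forall>n. bij_betw (homology_map B dB f n) (homology A dA n) (homology B dB n))"


section \<open>Dg algebras and deformation retracts\<close>

definition ksign :: "int \<Rightarrow> int"
  where "ksign k = (if even k then 1 else - 1)"

text \<open>\<open>mul m n\<close> is the component \<open>X m \<times> X n \<rightarrow> X (m + n)\<close> of the product.\<close>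

locale dg_algebra = complex_of_modules R X d
  for R :: "('r, 'k) ring_scheme" (structure)
    and X :: "int \<Rightarrow> ('r, 'x, 'm) module_scheme"
    and d :: "int \<Rightarrow> 'x \<Rightarrow> 'x"
    and mul :: "int \<Rightarrow> int \<Rightarrow> 'x \<Rightarrow> 'x \<Rightarrow> 'x"
    and unit :: 'x +
  assumes nonneg: "n < 0 \<Longrightarrow> carrier (X n) = {\<zero>\<^bsub>X n\<^esub>}"
    and mul_linear_left:
      "b \<in> carrier (X n) \<Longrightarrow> (\<lambda>a. mul m n a b) \<in> linear_maps R (X m) (X (m + n))"
    and mul_linear_right:
      "a \<in> carrier (X m) \<Longrightarrow> (\<lambda>b. mul m n a b) \<in> linear_maps R (X n) (X (m + n))"
    and mul_assoc:
      "\<lbrakk>a \<in> carrier (X k); b \<in> carrier (X m); c \<in> carrier (X n)\<rbrakk> \<Longrightarrow>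
        mul (k + m) n (mul k m a b) c = mul k (m + n) a (mul m n b c)"
    and unit_closed: "unit \<in> carrier (X 0)"
    and unit_left: "a \<in> carrier (X n) \<Longrightarrow> mul 0 n unit a = a"
    and unit_right: "a \<in> carrier (X n) \<Longrightarrow> mul n 0 a unit = a"
    and leibniz:
      "\<lbrakk>a \<in> carrier (X m); b \<in> carrier (X n)\<rbrakk> \<Longrightarrow>
        d (m + n) (mul m n a b) =
          mul (m - 1) n (d m a) b
            \<oplus>\<^bsub>X (m + n - 1)\<^esub> [ksign m] \<cdot>\<^bsub>X (m + n - 1)\<^esub> mul m (n - 1) a (d n b)"
    and graded_commutative:
      "\<lbrakk>a \<in> carrier (X m); b \<in> carrier (X n)\<rbrakk> \<Longrightarrow>
        mul m n a b = [ksign (m * n)] \<cdot>\<^bsub>X (m + n)\<^esub> mul n m b a"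
    and odd_square: "\<lbrakk>a \<in> carrier (X m); odd m\<rbrakk> \<Longrightarrow> mul m m a a = \<zero>\<^bsub>X (m + m)\<^esub>"

locale deformation_retract =
  X: complex_of_modules R X dX + Y: complex_of_modules R Y dY
  for R :: "('r, 'k) ring_scheme" (structure)
    and X :: "int \<Rightarrow> ('r, 'x, 'm) module_scheme"
    and dX :: "int \<Rightarrow> 'x \<Rightarrow> 'x"
    and Y :: "int \<Rightarrow> ('r, 'y, 'n) module_scheme"
    and dY :: "int \<Rightarrow> 'y \<Rightarrow> 'y"
    and i :: "int \<Rightarrow> 'y \<Rightarrow> 'x"
    and p :: "int \<Rightarrow> 'x \<Rightarrow> 'y"
    and h :: "int \<Rightarrow> 'x \<Rightarrow> 'x" +
  assumes i_quasi_iso: "quasi_isomorphism R Y dY X dX i"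
    and p_quasi_iso: "quasi_isomorphism R X dX Y dY p"
    and h_linear: "h n \<in> linear_maps R (X n) (X (n + 1))"
    and i_p: "x \<in> carrier (X n) \<Longrightarrow>
      i n (p n x) = x \<oplus>\<^bsub>X n\<^esub> dX (n + 1) (h n x) \<oplus>\<^bsub>X n\<^esub> h (n - 1) (dX n x)"
    and p_i: "y \<in> carrier (Y n) \<Longrightarrow> p n (i n y) = y"

text \<open>
  \<open>h (a b) \<in> h(a) X + X h(b)\<close> for homogeneous \<open>a\<close>, \<open>b\<close> of degrees \<open>m\<close>, \<open>n\<close>: the component of
  degree \<open>m + n + 1\<close> of the right-hand side is \<open>h(a) X\<^sub>n + X\<^sub>m h(b)\<close>.
\<close>

definition generalized_leibniz ::
  "(int \<Rightarrow> ('r, 'x, 'm) module_scheme) \<Rightarrow> (int \<Rightarrow> int \<Rightarrow> 'x \<Rightarrow> 'x \<Rightarrow> 'x) \<Rightarrow>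
   (int \<Rightarrow> 'x \<Rightarrow> 'x) \<Rightarrow> bool"
  where "generalized_leibniz X mul h \<longleftrightarrow>
    (\<forall>m n. \<forall>a\<in>carrier (X m). \<forall>b\<in>carrier (X n).
      \<exists>x\<in>carrier (X n). \<exists>y\<in>carrier (X m).
        h (m + n) (mul m n a b) =
          mul (m + 1) n (h m a) x \<oplus>\<^bsub>X (m + n + 1)\<^esub> mul m (n + 1) y (h n b))"


section \<open>A-infinity algebras\<close>

text \<open>
  A homogeneous element is passed to a multilinear operation together with its degree, so that
  an \<open>n\<close>-ary operation takes a list of \<open>n\<close> pairs (degree, element), standing for the
  elementary tensor of its entries.
\<close>

definition homogeneous_tuple :: "(int \<Rightarrow> ('r, 'a, 'm) module_scheme) \<Rightarrow> (int \<times> 'a) list \<Rightarrow> bool"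
  where "homogeneous_tuple A xs \<longleftrightarrow> (\<forall>(k, x)\<in>set xs. x \<in> carrier (A k))"

definition total_degree :: "(int \<times> 'a) list \<Rightarrow> int"
  where "total_degree xs = sum_list (map fst xs)"

text \<open>
  \<open>stasheff_term A m r s t xs\<close> is \<open>(-1)\<^sup>r\<^sup>+\<^sup>s\<^sup>t m\<^sub>r\<^sub>+\<^sub>1\<^sub>+\<^sub>t (1\<^sup>\<otimes>\<^sup>r \<otimes> m\<^sub>s \<otimes> 1\<^sup>\<otimes>\<^sup>t)\<close> evaluated at \<open>xs\<close>.
  Since \<open>m\<^sub>s\<close> has degree \<open>s - 2\<close>, moving it past the first \<open>r\<close> entries contributes a
  further Koszul sign.
\<close>

definition stasheff_term ::
  "(int \<Rightarrow> ('r, 'a, 'm) module_scheme) \<Rightarrow> (nat \<Rightarrow> (int \<times> 'a) list \<Rightarrow> 'a) \<Rightarrow>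
   nat \<Rightarrow> nat \<Rightarrow> nat \<Rightarrow> (int \<times> 'a) list \<Rightarrow> 'a"
  where "stasheff_term A m r s t xs =
    (let us = take r xs; vs = take s (drop r xs); ws = drop (r + s) xs in
      [ksign (int (r + s * t) + (int s - 2) * total_degree us)]
        \<cdot>\<^bsub>A (total_degree xs + int (r + s + t) - 3)\<^esub>
          m (r + 1 + t) (us @ (total_degree vs + int s - 2, m s vs) # ws))"

locale A_infinity_algebra = complex_of_modules R A d
  for R :: "('r, 'k) ring_scheme" (structure)
    and A :: "int \<Rightarrow> ('r, 'a, 'm) module_scheme"
    and d :: "int \<Rightarrow> 'a \<Rightarrow> 'a"
    and m :: "nat \<Rightarrow> (int \<times> 'a) list \<Rightarrow> 'a" +
  assumes multilinear:
      "\<lbrakk>n = length us + 1 + length vs; homogeneous_tuple A us; homogeneous_tuple A vs\<rbrakk> \<Longrightarrow>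
        (\<lambda>x. m n (us @ (k, x) # vs))
          \<in> linear_maps R (A k) (A (total_degree us + k + total_degree vs + int n - 2))"
    and m_1: "x \<in> carrier (A k) \<Longrightarrow> m 1 [(k, x)] = d k x"
    and stasheff:
      "\<lbrakk>n \<ge> 1; length xs = n; homogeneous_tuple A xs\<rbrakk> \<Longrightarrow>
        finsum (A (total_degree xs + int n - 3)) (\<lambda>(r, s, t). stasheff_term A m r s t xs)
          {(r, s, t). 1 \<le> s \<and> r + s + t = n} = \<zero>\<^bsub>A (total_degree xs + int n - 3)\<^esub>"


section \<open>Homotopy transfer\<close>

datatype pbt = Leaf | Node pbt pbt

fun leaves :: "pbt \<Rightarrow> nat"
  where
    "leaves Leaf = 1"
  | "leaves (Node S T) = leaves S + leaves T"

definition PBT :: "nat \<Rightarrow> pbt set"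
  where "PBT n = {T. leaves T = n}"

lemma leaves_pos: "leaves T \<ge> 1"
  by (induction T) auto

text \<open>In particular the sums over \<open>PBT n\<close> below are not degenerate.\<close>

lemma finite_PBT: "finite (PBT n)"
proof -
  have "finite {T. leaves T \<le> n}"
  proof (induction n)
    case 0
    have "{T. leaves T \<le> 0} = {}"
      by (simp add: leaves_pos Suc_le_lessD[OF leaves_pos[unfolded One_nat_def]])
    then show ?case by (simp only: finite.emptyI)
  next
    case (Suc n)
    let ?A = "{T. leaves T \<le> n}"
    have "{T. leaves T \<le> Suc n} \<subseteq> insert Leaf ((\<lambda>(S, T). Node S T) ` (?A \<times> ?A))"
    proof
      fix T assume T: "T \<in> {T. leaves T \<le> Suc n}"
      show "T \<in> insert Leaf ((\<lambda>(S, T). Node S T) ` (?A \<times> ?A))"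
      proof (cases T)
        case (Node U V)
        with T leaves_pos[of U] leaves_pos[of V] have "U \<in> ?A" "V \<in> ?A" by auto
        with Node show ?thesis by auto
      qed simp
    qed
    with Suc show ?case by (meson finite_SigmaI finite_imageI finite_insert finite_subset)
  qed
  then show ?thesis by (rule rev_finite_subset) (auto simp: PBT_def)
qed

text \<open>
  \<open>tensor_mul X mul f S g T ys\<close> is \<open>m\<^sub>2 (f \<otimes> g)\<close> at \<open>ys\<close>, where \<open>f\<close> and \<open>g\<close> are of the form \<open>\<phi>\<^sub>S\<close> and \<open>\<phi>\<^sub>T\<close>.
  The map \<open>\<phi>\<^sub>T\<close> has degree \<open>leaves T - 1\<close> (one \<open>h\<close> for each internal vertex), whence the degrees
  of the two factors and the Koszul sign \<open>(f \<otimes> g)(u \<otimes> v) = (-1)\<^bsup>|g||u|\<^esup> f(u) \<otimes> g(v)\<close>.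
\<close>

definition tensor_mul ::
  "(int \<Rightarrow> ('r, 'x, 'm) module_scheme) \<Rightarrow> (int \<Rightarrow> int \<Rightarrow> 'x \<Rightarrow> 'x \<Rightarrow> 'x) \<Rightarrow>
   ((int \<times> 'y) list \<Rightarrow> 'x) \<Rightarrow> pbt \<Rightarrow> ((int \<times> 'y) list \<Rightarrow> 'x) \<Rightarrow> pbt \<Rightarrow> (int \<times> 'y) list \<Rightarrow> 'x"
  where "tensor_mul X mul f S g T ys =
    (let us = take (leaves S) ys; vs = drop (leaves S) ys;
         k = total_degree us + int (leaves S) - 1;
         l = total_degree vs + int (leaves T) - 1
     in [ksign ((int (leaves T) - 1) * total_degree us)] \<cdot>\<^bsub>X (k + l)\<^esub> mul k l (f us) (g vs))"

primrec tree_phi ::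
  "(int \<Rightarrow> ('r, 'x, 'm) module_scheme) \<Rightarrow> (int \<Rightarrow> int \<Rightarrow> 'x \<Rightarrow> 'x \<Rightarrow> 'x) \<Rightarrow>
   (int \<Rightarrow> 'y \<Rightarrow> 'x) \<Rightarrow> (int \<Rightarrow> 'x \<Rightarrow> 'x) \<Rightarrow> pbt \<Rightarrow> (int \<times> 'y) list \<Rightarrow> 'x"
  where
    "tree_phi X mul i h Leaf = (\<lambda>ys. i (fst (hd ys)) (snd (hd ys)))"
  | "tree_phi X mul i h (Node S T) = (\<lambda>ys.
      h (total_degree ys + int (leaves S + leaves T) - 2)
        (tensor_mul X mul (tree_phi X mul i h S) S (tree_phi X mul i h T) T ys))"

text \<open>The value on \<open>Leaf\<close> is never used, since trees index the operations only for \<open>n \<ge> 2\<close>.\<close>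

fun tree_op ::
  "(int \<Rightarrow> ('r, 'x, 'm) module_scheme) \<Rightarrow> (int \<Rightarrow> int \<Rightarrow> 'x \<Rightarrow> 'x \<Rightarrow> 'x) \<Rightarrow>
   (int \<Rightarrow> 'y \<Rightarrow> 'x) \<Rightarrow> (int \<Rightarrow> 'x \<Rightarrow> 'y) \<Rightarrow> (int \<Rightarrow> 'x \<Rightarrow> 'x) \<Rightarrow>
   pbt \<Rightarrow> (int \<times> 'y) list \<Rightarrow> 'y"
  where
    "tree_op X mul i p h Leaf ys = undefined"
  | "tree_op X mul i p h (Node S T) ys =
      p (total_degree ys + int (leaves S + leaves T) - 2)
        (tensor_mul X mul (tree_phi X mul i h S) S (tree_phi X mul i h T) T ys)"

definition transferred_op ::
  "(int \<Rightarrow> ('r, 'x, 'm) module_scheme) \<Rightarrow> (int \<Rightarrow> int \<Rightarrow> 'x \<Rightarrow> 'x \<Rightarrow> 'x) \<Rightarrow>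
   (int \<Rightarrow> ('r, 'y, 'n) module_scheme) \<Rightarrow> (int \<Rightarrow> 'y \<Rightarrow> 'y) \<Rightarrow>
   (int \<Rightarrow> 'y \<Rightarrow> 'x) \<Rightarrow> (int \<Rightarrow> 'x \<Rightarrow> 'y) \<Rightarrow> (int \<Rightarrow> 'x \<Rightarrow> 'x) \<Rightarrow> (pbt \<Rightarrow> int) \<Rightarrow>
   nat \<Rightarrow> (int \<times> 'y) list \<Rightarrow> 'y"
  where "transferred_op X mul Y dY i p h \<epsilon> n ys =
    (if n = 1 then dY (fst (hd ys)) (snd (hd ys))
     else (\<Oplus>\<^bsub>Y (total_degree ys + int n - 2)\<^esub>T\<in>PBT n.
             [\<epsilon> T] \<cdot>\<^bsub>Y (total_degree ys + int n - 2)\<^esub> tree_op X mul i p h T ys))"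

definition characteristic_zero :: "('r, 'k) ring_scheme \<Rightarrow> bool"
  where "characteristic_zero R \<longleftrightarrow> (\<forall>n::nat. n > 0 \<longrightarrow> [n] \<cdot>\<^bsub>R\<^esub> \<one>\<^bsub>R\<^esub> \<noteq> \<zero>\<^bsub>R\<^esub>)"

end

theory Submission
  imports Defs
begin

text \<open>
  If \<open>h i = 0\<close>, the generalized Leibniz rule gives \<open>h (i(a) i(b)) \<in> h(i(a)) X + X h(i(b)) = 0\<close>,
  so \<open>\<phi>\<close> vanishes on the tree with two leaves. Every larger tree contains that tree, so by
  multilinearity \<open>\<phi>\<^sub>T = 0\<close> for every tree \<open>T\<close> with at least two leaves. When \<open>n \<ge> 3\<close>, one of the
  two subtrees at the root of \<open>T\<close> has at least two leaves, and hence \<open>m\<^sub>T = 0\<close>.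
\<close>

lemma linear_maps_closed:
  "f \<in> linear_maps R M N \<Longrightarrow> x \<in> carrier M \<Longrightarrow> f x \<in> carrier N"
  by (auto simp: linear_maps_def)

lemma linear_maps_zero:
  assumes "module R M" and "module R N" and f: "f \<in> linear_maps R M N"
  shows "f \<zero>\<^bsub>M\<^esub> = \<zero>\<^bsub>N\<^esub>"
proof -
  interpret M: module R M by fact
  interpret N: module R N by fact
  have z: "f \<zero>\<^bsub>M\<^esub> \<in> carrier N"
    using linear_maps_closed[OF f] by simp
  have "f (\<zero>\<^bsub>M\<^esub> \<oplus>\<^bsub>M\<^esub> \<zero>\<^bsub>M\<^esub>) = f \<zero>\<^bsub>M\<^esub> \<oplus>\<^bsub>N\<^esub> f \<zero>\<^bsub>M\<^esub>"
    using f M.zero_closed unfolding linear_maps_def by blast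
  then have "f \<zero>\<^bsub>M\<^esub> = f \<zero>\<^bsub>M\<^esub> \<oplus>\<^bsub>N\<^esub> f \<zero>\<^bsub>M\<^esub>"
    by simp
  with z show ?thesis
    by (metis N.add.r_cancel_one')
qed

lemma total_degree_append: "total_degree (us @ vs) = total_degree us + total_degree vs"
  by (simp add: total_degree_def)

lemma homogeneous_tuple_append:
  "homogeneous_tuple A (us @ vs) \<longleftrightarrow> homogeneous_tuple A us \<and> homogeneous_tuple A vs"
  by (auto simp: homogeneous_tuple_def)

context dg_algebra
begin

lemma component_add_pow_zero: "[(k::int)] \<cdot>\<^bsub>X n\<^esub> \<zero>\<^bsub>X n\<^esub> = \<zero>\<^bsub>X n\<^esub>"
proof -
  interpret module R "X n" by (rule component_module)
  show ?thesis by simp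
qed

lemma mul_zero_left: "b \<in> carrier (X n) \<Longrightarrow> mul m n \<zero>\<^bsub>X m\<^esub> b = \<zero>\<^bsub>X (m + n)\<^esub>"
  using linear_maps_zero[OF component_module component_module mul_linear_left] .

lemma mul_zero_right: "a \<in> carrier (X m) \<Longrightarrow> mul m n a \<zero>\<^bsub>X n\<^esub> = \<zero>\<^bsub>X (m + n)\<^esub>"
  using linear_maps_zero[OF component_module component_module mul_linear_right] .

text \<open>Bilinearity kills a product with a zero factor, and a signed multiple of zero is zero.
  Both factors are required to lie in their carriers because linearity in one argument is known only
  when the other is a genuine element. The shifts by 1 in the two degrees add up to the 2 in the
  conclusion.\<close>

lemma tensor_mul_append_zero:
  assumes "length us = leaves S"
    and "f us \<in> carrier (X (total_degree us + int (leaves S) - 1))"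
    and "g vs \<in> carrier (X (total_degree vs + int (leaves T) - 1))"
    and "f us = \<zero>\<^bsub>X (total_degree us + int (leaves S) - 1)\<^esub>
      \<or> g vs = \<zero>\<^bsub>X (total_degree vs + int (leaves T) - 1)\<^esub>"
  shows "tensor_mul X mul f S g T (us @ vs) =
    \<zero>\<^bsub>X (total_degree (us @ vs) + int (leaves S + leaves T) - 2)\<^esub>"
proof -
  define k l where "k = total_degree us + int (leaves S) - 1"
    and "l = total_degree vs + int (leaves T) - 1"
  then have "total_degree (us @ vs) + int (leaves S + leaves T) - 2 = k + l"
    by (simp add: total_degree_append)
  moreover have "mul k l (f us) (g vs) = \<zero>\<^bsub>X (k + l)\<^esub>"
    using assms(2-4) mul_zero_left mul_zero_right unfolding k_def l_def by metis
  moreover have "tensor_mul X mul f S g T (us @ vs) =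
      [ksign ((int (leaves T) - 1) * total_degree us)] \<cdot>\<^bsub>X (k + l)\<^esub> mul k l (f us) (g vs)"
    using assms(1) by (simp add: tensor_mul_def Let_def k_def l_def)
  ultimately show ?thesis
    by (metis component_add_pow_zero)
qed

context
  fixes Y :: "int \<Rightarrow> ('r, 'y, 'n) module_scheme"
    and i :: "int \<Rightarrow> 'y \<Rightarrow> 'x"
    and h :: "int \<Rightarrow> 'x \<Rightarrow> 'x"
  assumes i_closed: "\<And>n y. y \<in> carrier (Y n) \<Longrightarrow> i n y \<in> carrier (X n)"
    and h_linear: "\<And>n. h n \<in> linear_maps R (X n) (X (n + 1))"
    and h_leibniz: "generalized_leibniz X mul h"
    and h_i: "\<And>n y. y \<in> carrier (Y n) \<Longrightarrow> h n (i n y) = \<zero>\<^bsub>X (n + 1)\<^esub>"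
begin

lemma h_zero: "h n \<zero>\<^bsub>X n\<^esub> = \<zero>\<^bsub>X (n + 1)\<^esub>"
  by (rule linear_maps_zero[OF component_module component_module h_linear])

text \<open>The base case of the tree induction: in the generalized Leibniz rule the two summands
  carry the factors \<open>h (i a)\<close> and \<open>h (i b)\<close>, both zero since
  \<open>h i = 0\<close>.\<close>

lemma h_mul_i_i:
  assumes "a \<in> carrier (Y m)" and "b \<in> carrier (Y n)"
  shows "h (m + n) (mul m n (i m a) (i n b)) = \<zero>\<^bsub>X (m + n + 1)\<^esub>"
proof -
  interpret module R "X (m + n + 1)" by (rule component_module)
  obtain x y where x: "x \<in> carrier (X n)" and y: "y \<in> carrier (X m)"
    and eq: "h (m + n) (mul m n (i m a) (i n b)) =
      mul (m + 1) n (h m (i m a)) x \<oplus>\<^bsub>X (m + n + 1)\<^esub> mul m (n + 1) y (h n (i n b))"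
    using h_leibniz i_closed assms unfolding generalized_leibniz_def by blast
  \<comment> \<open>The two zeros come from components with differently bracketed indices, which
    must be identified before they can be added in \<open>X (m + n + 1)\<close>.\<close>
  have "m + 1 + n = m + n + 1" and "m + (n + 1) = m + n + 1"
    by simp_all
  then have "mul (m + 1) n \<zero>\<^bsub>X (m + 1)\<^esub> x = \<zero>\<^bsub>X (m + n + 1)\<^esub>"
    and "mul m (n + 1) y \<zero>\<^bsub>X (n + 1)\<^esub> = \<zero>\<^bsub>X (m + n + 1)\<^esub>"
    using mul_zero_left[OF x, of "m + 1"] mul_zero_right[OF y, of "n + 1"] by metis+
  then show ?thesis
    using eq by (simp add: h_i assms)
qed

text \<open>Closure is part of the induction since a leaf may contribute a nonzero
  \<open>i y\<close>: next to a vanishing subtree, this factor still has to be an element of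
  \<open>X\<close>.\<close>

lemma tree_phi_closed_and_zero:
  assumes "length ys = leaves T" and "homogeneous_tuple Y ys"
  shows "tree_phi X mul i h T ys \<in> carrier (X (total_degree ys + int (leaves T) - 1)) \<and>
    (T \<noteq> Leaf \<longrightarrow> tree_phi X mul i h T ys = \<zero>\<^bsub>X (total_degree ys + int (leaves T) - 1)\<^esub>)"
  using assms
proof (induction T arbitrary: ys)
  case Leaf
  then obtain k y where "ys = [(k, y)]"
    by (cases ys) auto
  with Leaf show ?case
    by (simp add: i_closed homogeneous_tuple_def total_degree_def)
next
  case (Node S T)
  define us vs where "us = take (leaves S) ys" and "vs = drop (leaves S) ys"
  then have ys: "ys = us @ vs" and len: "length us = leaves S" "length vs = leaves T"
    using Node.prems(1) by simp_all
  have hom: "homogeneous_tuple Y us" "homogeneous_tuple Y vs"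
    using Node.prems(2) by (simp_all add: ys homogeneous_tuple_append)
  let ?N = "total_degree ys + int (leaves S + leaves T) - 2"
  have "tree_phi X mul i h (Node S T) ys = \<zero>\<^bsub>X (?N + 1)\<^esub>"
  \<comment> \<open>Only when both subtrees are leaves can the product under \<open>h\<close> be
    nonzero; then \<open>h\<close> itself kills it. Otherwise the induction hypothesis makes one
    factor zero.\<close>
  proof (cases "S = Leaf \<and> T = Leaf")
    case True
    with len obtain k a l b where uv: "us = [(k, a)]" "vs = [(l, b)]"
      by (cases us; cases vs) auto
    with hom have ab: "a \<in> carrier (Y k)" "b \<in> carrier (Y l)"
      by (auto simp: homogeneous_tuple_def)
    interpret module R "X (k + l)" by (rule component_module)
    \<comment> \<open>On a leaf the map is \<open>i\<close>, of degree 0, so the Koszul sign is 1.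
      Removing the multiple by 1 requires the product to lie in the carrier.\<close>
    have "mul k l (i k a) (i l b) \<in> carrier (X (k + l))"
      using linear_maps_closed[OF mul_linear_left] ab i_closed by blast
    with True show ?thesis
      using h_mul_i_i[OF ab]
      by (simp add: ys uv tensor_mul_def Let_def total_degree_def ksign_def)
  next
    case False
    have "tensor_mul X mul (tree_phi X mul i h S) S (tree_phi X mul i h T) T (us @ vs) =
        \<zero>\<^bsub>X (total_degree (us @ vs) + int (leaves S + leaves T) - 2)\<^esub>"
      using Node.IH(1)[OF len(1) hom(1)] Node.IH(2)[OF len(2) hom(2)] False
      by (intro tensor_mul_append_zero[OF len(1)]) auto
    then show ?thesis
      by (simp add: h_zero ys del: of_nat_add)
  qed
  moreover have "?N + 1 = total_degree ys + int (leaves (Node S T)) - 1"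
    by simp
  moreover have "\<zero>\<^bsub>X (?N + 1)\<^esub> \<in> carrier (X (?N + 1))"
    using abelian_group.axioms(1)[OF module.axioms(2)[OF component_module]]
    by (rule abelian_monoid.zero_closed)
  ultimately show ?case
    by metis
qed

text \<open>The root carries \<open>p\<close> instead of \<open>h\<close>, so vanishing must come
  from a factor of the root product. This explains the bound 3: two leaves give
  \<open>p (i(a) i(b))\<close>, which can be nonzero.\<close>

lemma tree_op_zero:
  fixes p :: "int \<Rightarrow> 'x \<Rightarrow> 'y"
  assumes p_zero: "\<And>n. p n \<zero>\<^bsub>X n\<^esub> = \<zero>\<^bsub>Y n\<^esub>"
    and "leaves T \<ge> 3" and len: "length ys = leaves T" and hom: "homogeneous_tuple Y ys"
  shows "tree_op X mul i p h T ys = \<zero>\<^bsub>Y (total_degree ys + int (leaves T) - 2)\<^esub>"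
proof (cases T)
  case Leaf
  with assms(2) show ?thesis by simp
next
  case (Node U V)
  define us vs where "us = take (leaves U) ys" and "vs = drop (leaves U) ys"
  with Node len have ys: "ys = us @ vs" and lens: "length us = leaves U" "length vs = leaves V"
    by simp_all
  have homs: "homogeneous_tuple Y us" "homogeneous_tuple Y vs"
    using hom by (simp_all add: ys homogeneous_tuple_append)
  \<comment> \<open>Two leaf subtrees would give only two leaves in total.\<close>
  have "U \<noteq> Leaf \<or> V \<noteq> Leaf"
    using assms(2) Node by auto
  then have "tensor_mul X mul (tree_phi X mul i h U) U (tree_phi X mul i h V) V (us @ vs) =
      \<zero>\<^bsub>X (total_degree (us @ vs) + int (leaves U + leaves V) - 2)\<^esub>"
    using tree_phi_closed_and_zero[OF lens(1) homs(1)] tree_phi_closed_and_zero[OF lens(2) homs(2)]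
    by (intro tensor_mul_append_zero[OF lens(1)]) auto
  with Node show ?thesis
    by (simp add: ys p_zero del: of_nat_add)
qed

end

end

theorem proposition2p5:
  fixes R :: "('r, 'k) ring_scheme"
    and X :: "int \<Rightarrow> ('r, 'x, 'm) module_scheme"
    and Y :: "int \<Rightarrow> ('r, 'y, 'n) module_scheme"
    and mul :: "int \<Rightarrow> int \<Rightarrow> 'x \<Rightarrow> 'x \<Rightarrow> 'x"
    and unit :: 'x
    and dX :: "int \<Rightarrow> 'x \<Rightarrow> 'x"
    and dY :: "int \<Rightarrow> 'y \<Rightarrow> 'y"
    and i :: "int \<Rightarrow> 'y \<Rightarrow> 'x"
    and p :: "int \<Rightarrow> 'x \<Rightarrow> 'y"
    and h :: "int \<Rightarrow> 'x \<Rightarrow> 'x"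
    and \<epsilon> :: "pbt \<Rightarrow> int"
  assumes "cring R"
    and "dg_algebra R X dX mul unit"
    and "deformation_retract R X dX Y dY i p h"
    and "generalized_leibniz X mul h"
    and "\<And>n y. y \<in> carrier (Y n) \<Longrightarrow> h n (i n y) = \<zero>\<^bsub>X (n + 1)\<^esub>"
    and "\<And>T. \<epsilon> T \<in> {1, - 1}"
    and "(field R \<and> characteristic_zero R) \<or>
      A_infinity_algebra R Y dY (transferred_op X mul Y dY i p h \<epsilon>)"
  shows "\<forall>n\<ge>3. \<forall>ys. length ys = n \<and> homogeneous_tuple Y ys \<longrightarrow>
    transferred_op X mul Y dY i p h \<epsilon> n ys = \<zero>\<^bsub>Y (total_degree ys + int n - 2)\<^esub>"
proof (intro allI impI)
  fix n :: nat and ys :: "(int \<times> 'y) list"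
  assume n: "n \<ge> 3" and "length ys = n \<and> homogeneous_tuple Y ys"
  then have len: "length ys = n" and hom: "homogeneous_tuple Y ys"
    by auto
  interpret dg_algebra R X dX mul unit by fact
  interpret DR: deformation_retract R X dX Y dY i p h by fact
  let ?N = "total_degree ys + int n - 2"
  interpret YN: module R "Y ?N" by (rule DR.Y.component_module)
  have i: "i k y \<in> carrier (X k)" if "y \<in> carrier (Y k)" for k y
    using DR.i_quasi_iso that linear_maps_closed
    unfolding quasi_isomorphism_def chain_map_def by metis
  have "p k \<in> linear_maps R (X k) (Y k)" for k
    using DR.p_quasi_iso unfolding quasi_isomorphism_def chain_map_def by blast
  then have p: "p k \<zero>\<^bsub>X k\<^esub> = \<zero>\<^bsub>Y k\<^esub>" for k
    by (rule linear_maps_zero[OF component_module DR.Y.component_module])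
  have "tree_op X mul i p h T ys = \<zero>\<^bsub>Y ?N\<^esub>" if "T \<in> PBT n" for T
    using tree_op_zero[where Y = Y and i = i and h = h and p = p and T = T and ys = ys,
        OF i DR.h_linear assms(4,5) p] n len hom that
    by (simp add: PBT_def)
  \<comment> \<open>The sum vanishes term by term, with no cancellation between different trees:
    each summand is an integer multiple of zero.\<close>
  then have "(\<Oplus>\<^bsub>Y ?N\<^esub>T\<in>PBT n. [\<epsilon> T] \<cdot>\<^bsub>Y ?N\<^esub> tree_op X mul i p h T ys)
      = (\<Oplus>\<^bsub>Y ?N\<^esub>T\<in>PBT n. \<zero>\<^bsub>Y ?N\<^esub>)"
    by (intro YN.finsum_cong') auto
  with n show "transferred_op X mul Y dY i p h \<epsilon> n ys = \<zero>\<^bsub>Y ?N\<^esub>"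
    by (simp add: transferred_op_def)
qed

end
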